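(* Let $A\in\mathbb{DQ}^{n\times n}$ be a Hermitian dual quaternion matrix with $A_{st}\ne O$. Then $A$ has exactly $n$ eigenvalues (counted with multiplicity), which are all dual numbers, and there are also $n$ eigenvectors associated with these $n$ eigenvalues. The Hermitian matrix $A$ is positive semidefinite if and only if all of these eigenvalues are nonnegative, and $A$ is positive definite if and only if all of these eigenvalues are positive and appreciable.
   Context: $\mathbb{Q}$ denotes the real quaternions and $q^*$ the quaternion conjugate. $\epsilon$ is the infinitesimal unit: $\epsilon\neq 0$, $\epsilon^2=0$, and $\epsilon$ commutes with all quaternions. A dual number is $q_{st}+q_{\mathcal I}\epsilon$ with $q_{st},q_{\mathcal I}\in\mathbb{R}$. A dual quaternion is $q=q_{st}+q_{\mathcal I}\epsilon$ with $q_{st},q_{\mathcal I}\in\mathbb{Q}$ (set $\mathbb{DQ}$), with conjugate $q^*=q_{st}^*+q_{\mathcal I}^*\epsilon$. A dual quaternion (in particular a dual number) is appreciable if $q_{st}\ne0$; a vector in $\mathbb{DQ}^n$ is appreciable if at least one component is appreciable. A matrix over $\mathbb{DQ}$ is written $A=A_{st}+A_{\mathcal I}\epsilon$ with quaternion matrices $A_{st},A_{\mathcal I}$; $^*$ denotes conjugate transpose. $A$ is Hermitian if $A^*=A$; a square $U$ is unitary if $U^*U=I$. Total order on dual numbers: $p\le q$ iff $p_{st}<q_{st}$, or $p_{st}=q_{st}$ and $p_{\mathcal I}\le q_{\mathcal I}$; positive means $>0$, nonnegative means $\ge0$. Right eigenvalue of $A\in\mathbb{DQ}^{n\times n}$: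 $\lambda\in\mathbb{DQ}$ such that $A\mathbf{x}=\mathbf{x}\lambda$ for some appreciable $\mathbf{x}\in\mathbb{DQ}^n$; if $\lambda$ is a dual number it is called an eigenvalue of $A$, with $\mathbf{x}$ an associated eigenvector. The count of eigenvalues of a Hermitian $A$ is with multiplicity: there is a unitary $U\in\mathbb{DQ}^{n\times n}$ such that $U^*AU$ is a diagonal matrix of dual numbers; its $n$ diagonal entries (unique up to order) are the eigenvalues of $A$ with multiplicity, every eigenvalue (indeed every right eigenvalue) of $A$ occurs among them, and the columns of $U$ are associated eigenvectors. For Hermitian $A\in\mathbb{DQ}^{n\times n}$, $\mathbf{x}^*A\mathbf{x}$ is always a dual number. $A$ is positive semidefinite if $\mathbf{x}^*A\mathbf{x}\ge0$ for all $\mathbf{x}\in\mathbb{DQ}^n$, and positive definite if $\mathbf{x}^*A\mathbf{x}$ is positive and appreciable for all appreciable $\mathbf{x}\in\mathbb{DQ}^n$. *)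

theory Defs
  imports "HOL-Analysis.Analysis"
begin

datatype quat = Quat (q1: real) (qi: real) (qj: real) (qk: real)

lemma quat_eq_iff: "p = q \<longleftrightarrow> q1 p = q1 q \<and> qi p = qi q \<and> qj p = qj q \<and> qk p = qk q"
  by (auto intro: quat.expand)

instantiation quat :: real_algebra_1
begin

definition "0 = Quat 0 0 0 0"
definition "1 = Quat 1 0 0 0"
definition "p + q = Quat (q1 p + q1 q) (qi p + qi q) (qj p + qj q) (qk p + qk q)"
definition "- p = Quat (- q1 p) (- qi p) (- qj p) (- qk p)"
definition "p - q = Quat (q1 p - q1 q) (qi p - qi q) (qj p - qj q) (qk p - qk q)"
definition "r *\<^sub>R p = Quat (r * q1 p) (r * qi p) (r * qj p) (r * qk p)"
definition "p * q = Quat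
  (q1 p * q1 q - qi p * qi q - qj p * qj q - qk p * qk q)
  (q1 p * qi q + qi p * q1 q + qj p * qk q - qk p * qj q)
  (q1 p * qj q - qi p * qk q + qj p * q1 q + qk p * qi q)
  (q1 p * qk q + qi p * qj q - qj p * qi q + qk p * q1 q)"

instance
  by standard
    (simp_all add: quat_eq_iff zero_quat_def one_quat_def plus_quat_def uminus_quat_def
      minus_quat_def scaleR_quat_def times_quat_def algebra_simps)

end

definition quat_cnj :: "quat \<Rightarrow> quat" where
  "quat_cnj q = Quat (q1 q) (- qi q) (- qj q) (- qk q)"

text \<open>\<open>Dual a b\<close> stands for \<open>a + b \<epsilon>\<close> with \<open>\<epsilon>\<^sup>2 = 0\<close> and \<open>\<epsilon>\<close> central. The coefficients may be
  taken from any ring: the reals give the dual numbers, the quaternions the dual quaternions.\<close>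

datatype 'a dual_over = Dual (st_part: 'a) (eps_part: 'a)

type_synonym dual_number = "real dual_over"
type_synonym dual_quat = "quat dual_over"

lemma dual_eq_iff: "p = q \<longleftrightarrow> st_part p = st_part q \<and> eps_part p = eps_part q"
  by (auto intro: dual_over.expand)

instantiation dual_over :: (zero) zero
begin
definition "0 = Dual 0 0"
instance ..
end

instantiation dual_over :: (ring_1) ring_1
begin

definition "1 = Dual 1 0"
definition "p + q = Dual (st_part p + st_part q) (eps_part p + eps_part q)"
definition "- p = Dual (- st_part p) (- eps_part p)"
definition "p - q = Dual (st_part p - st_part q) (eps_part p - eps_part q)"
definition "p * q = Dual (st_part p * st_part q) (st_part p * eps_part q + eps_part p * st_part q)"

instance
  by standard
    (simp_all add: dual_eq_iff zero_dual_over_def one_dual_over_def plus_dual_over_def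
      uminus_dual_over_def minus_dual_over_def times_dual_over_def algebra_simps)

end

instantiation dual_over :: (linorder) linorder
begin

definition "p \<le> q \<longleftrightarrow>
  st_part p < st_part q \<or> (st_part p = st_part q \<and> eps_part p \<le> eps_part q)"
definition "p < q \<longleftrightarrow>
  st_part p < st_part q \<or> (st_part p = st_part q \<and> eps_part p < eps_part q)"

instance
  by standard (auto simp: less_eq_dual_over_def less_dual_over_def dual_eq_iff)

end

definition appreciable :: "'a::zero dual_over \<Rightarrow> bool" where
  "appreciable p \<longleftrightarrow> st_part p \<noteq> 0"

definition dq_cnj :: "dual_quat \<Rightarrow> dual_quat" where
  "dq_cnj q = Dual (quat_cnj (st_part q)) (quat_cnj (eps_part q))"

definition dq_of_dual :: "dual_number \<Rightarrow> dual_quat" where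
  "dq_of_dual p = Dual (of_real (st_part p)) (of_real (eps_part p))"

definition appreciable_vec :: "dual_quat^'n \<Rightarrow> bool" where
  "appreciable_vec x \<longleftrightarrow> (\<exists>i. appreciable (x $ i))"

definition st_mat :: "dual_quat^'n^'m \<Rightarrow> quat^'n^'m" where
  "st_mat A = (\<chi> i j. st_part (A $ i $ j))"

definition ctranspose :: "dual_quat^'n^'m \<Rightarrow> dual_quat^'m^'n" where
  "ctranspose A = (\<chi> i j. dq_cnj (A $ j $ i))"

definition dq_hermitian :: "dual_quat^'n^'n \<Rightarrow> bool" where
  "dq_hermitian A \<longleftrightarrow> ctranspose A = A"

definition dq_unitary :: "dual_quat^'n^'n \<Rightarrow> bool" where
  "dq_unitary U \<longleftrightarrow> ctranspose U ** U = mat 1"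

definition dual_diag :: "('n \<Rightarrow> dual_number) \<Rightarrow> dual_quat^'n^'n" where
  "dual_diag d = (\<chi> i j. if i = j then dq_of_dual (d i) else 0)"

definition vec_mult_right :: "dual_quat^'n \<Rightarrow> dual_quat \<Rightarrow> dual_quat^'n" where
  "vec_mult_right x l = (\<chi> i. x $ i * l)"

text \<open>\<open>quad_form A x\<close> is \<open>x\<^sup>* A x\<close>.\<close>

definition quad_form :: "dual_quat^'n^'n \<Rightarrow> dual_quat^'n \<Rightarrow> dual_quat" where
  "quad_form A x = (\<Sum>i\<in>UNIV. dq_cnj (x $ i) * (A *v x) $ i)"

definition right_eigenvalue :: "dual_quat^'n^'n \<Rightarrow> dual_quat \<Rightarrow> bool" where
  "right_eigenvalue A l \<longleftrightarrow> (\<exists>x. appreciable_vec x \<and> A *v x = vec_mult_right x l)"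

definition dq_eigenvector :: "dual_quat^'n^'n \<Rightarrow> dual_number \<Rightarrow> dual_quat^'n \<Rightarrow> bool" where
  "dq_eigenvector A l x \<longleftrightarrow> appreciable_vec x \<and> A *v x = vec_mult_right x (dq_of_dual l)"

definition dq_eigenvalue :: "dual_quat^'n^'n \<Rightarrow> dual_number \<Rightarrow> bool" where
  "dq_eigenvalue A l \<longleftrightarrow> right_eigenvalue A (dq_of_dual l)"

definition diagonalizes :: "dual_quat^'n^'n \<Rightarrow> dual_quat^'n^'n \<Rightarrow> ('n \<Rightarrow> dual_number) \<Rightarrow> bool" where
  "diagonalizes U A d \<longleftrightarrow> dq_unitary U \<and> ctranspose U ** A ** U = dual_diag d"

text \<open>\<open>L\<close> is the multiset of eigenvalues of the Hermitian matrix \<open>A\<close>, counted with multiplicity: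
  the diagonal entries of a unitary diagonalization of \<open>A\<close>. This is a relation because neither
  existence nor independence of the diagonalization is known a priori.\<close>

definition eigenvalue_mset :: "dual_quat^'n^'n \<Rightarrow> dual_number multiset \<Rightarrow> bool" where
  "eigenvalue_mset A L \<longleftrightarrow> (\<exists>U d. diagonalizes U A d \<and> L = image_mset d (mset_set UNIV))"

text \<open>Order relations are only available between dual numbers, so each condition on \<open>x\<^sup>* A x\<close>
  includes that it is one; for Hermitian \<open>A\<close> this holds automatically.\<close>

definition dq_pos_semidef :: "dual_quat^'n^'n \<Rightarrow> bool" where
  "dq_pos_semidef A \<longleftrightarrow> (\<forall>x. \<exists>p. quad_form A x = dq_of_dual p \<and> 0 \<le> p)"

definition dq_pos_def :: "dual_quat^'n^'n \<Rightarrow> bool" where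
  "dq_pos_def A \<longleftrightarrow>
    (\<forall>x. appreciable_vec x \<longrightarrow> (\<exists>p. quad_form A x = dq_of_dual p \<and> 0 < p \<and> appreciable p))"

end

theory Submission imports Defs begin

text \<open>A Hermitian quaternion matrix \<open>A\<close> has eigenvectors in every nonzero invariant right
  subspace: they maximize the form \<open>x\<^sup>* A x\<close> on the unit sphere. For a Hermitian matrix
  \<open>A + B\<epsilon>\<close>, maximizing the form of \<open>B\<close> within the eigenspaces of \<open>A\<close> yields an orthonormal
  eigenbasis of \<open>A\<close> in which \<open>B\<close> has no off-diagonal entries inside an eigenspace, and the
  remaining off-diagonal entries are removed by a conjugation with some \<open>I + S\<epsilon>\<close>. Once
  \<open>U\<^sup>* A U\<close> is diagonal with entries \<open>d\<^sub>i\<close>, the substitution \<open>y = U\<^sup>* x\<close> turns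
  \<open>x\<^sup>* A x\<close> into \<open>\<Sum> d\<^sub>i y\<^sub>i\<^sup>* y\<^sub>i\<close> and \<open>A x = x \<lambda>\<close> into \<open>d\<^sub>i y\<^sub>i = y\<^sub>i \<lambda>\<close>, from which the
  statements on definiteness and on right eigenvalues are read off.\<close>

section \<open>The quaternions as a Euclidean space\<close>

lemmas quat_defs = zero_quat_def one_quat_def plus_quat_def uminus_quat_def
  minus_quat_def scaleR_quat_def times_quat_def

lemma quat_sel [simp]:
  "q1 0 = 0" "qi 0 = 0" "qj 0 = 0" "qk 0 = 0"
  "q1 1 = 1" "qi 1 = 0" "qj 1 = 0" "qk 1 = 0"
  "q1 (p + q) = q1 p + q1 q" "qi (p + q) = qi p + qi q"
  "qj (p + q) = qj p + qj q" "qk (p + q) = qk p + qk q"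
  "q1 (- p) = - q1 p" "qi (- p) = - qi p" "qj (- p) = - qj p" "qk (- p) = - qk p"
  "q1 (p - q) = q1 p - q1 q" "qi (p - q) = qi p - qi q"
  "qj (p - q) = qj p - qj q" "qk (p - q) = qk p - qk q"
  "q1 (r *\<^sub>R p) = r * q1 p" "qi (r *\<^sub>R p) = r * qi p"
  "qj (r *\<^sub>R p) = r * qj p" "qk (r *\<^sub>R p) = r * qk p"
  by (simp_all add: quat_defs)

instantiation quat :: real_inner
begin

definition "inner p q = q1 p * q1 q + qi p * qi q + qj p * qj q + qk p * qk q" for p q :: quat
definition "norm p = sqrt (inner p p)" for p :: quat
definition "sgn p = inverse (norm p) *\<^sub>R p" for p :: quat
definition "dist p q = norm (p - q)" for p q :: quat
definition "(uniformity :: (quat \<times> quat) filter) = (INF e\<in>{0<..}. principal {(x, y). dist x y < e})"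
definition "open S \<longleftrightarrow> (\<forall>x\<in>S. \<forall>\<^sub>F (x', y) in uniformity. x' = x \<longrightarrow> y \<in> S)" for S :: "quat set"

instance
proof
  fix x y z :: quat and r :: real and S :: "quat set"
  show "dist x y = norm (x - y)" by (simp add: dist_quat_def)
  show "sgn x = x /\<^sub>R norm x" by (simp add: sgn_quat_def)
  show "(uniformity :: (quat \<times> quat) filter) = (INF e\<in>{0<..}. principal {(x, y). dist x y < e})"
    by (rule uniformity_quat_def)
  show "open S \<longleftrightarrow> (\<forall>x\<in>S. \<forall>\<^sub>F (x', y) in uniformity. x' = x \<longrightarrow> y \<in> S)"
    by (rule open_quat_def)
  show "inner x y = inner y x" by (simp add: inner_quat_def)
  show "inner (x + y) z = inner x z + inner y z" by (simp add: inner_quat_def algebra_simps)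
  show "inner (r *\<^sub>R x) y = r * inner x y" by (simp add: inner_quat_def algebra_simps)
  show "0 \<le> inner x x" by (simp add: inner_quat_def)
  have "a * a + b * b + c * c + d * d = 0 \<longleftrightarrow> a = 0 \<and> b = 0 \<and> c = 0 \<and> d = 0" for a b c d :: real
    by (smt (verit) mult_eq_0_iff zero_le_square)
  then show "inner x x = 0 \<longleftrightarrow> x = 0" by (simp add: inner_quat_def quat_eq_iff)
  show "norm x = sqrt (inner x x)" by (simp add: norm_quat_def)
qed

end

text \<open>Finite real dimension makes unit spheres in \<open>quat^'n\<close> compact and injective
  real-linear endomorphisms surjective. Maxima of Hermitian forms and dimension arguments rest on
  these two facts.\<close>

instantiation quat :: euclidean_space
begin

definition "Basis = {Quat 1 0 0 0, Quat 0 1 0 0, Quat 0 0 1 0, Quat 0 0 0 1}"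

instance
proof
  fix u v x :: quat
  show "(Basis :: quat set) \<noteq> {}" "finite (Basis :: quat set)"
    by (simp_all add: Basis_quat_def)
  show "inner u v = (if u = v then 1 else 0)" if "u \<in> Basis" "v \<in> Basis"
    using that unfolding Basis_quat_def inner_quat_def by (elim insertE) simp_all
  show "(\<forall>u\<in>Basis. inner x u = 0) \<longleftrightarrow> x = 0"
    unfolding Basis_quat_def inner_quat_def quat_eq_iff by simp
qed

end

section \<open>Quaternion vectors and matrices\<close>

lemma quat_cnj_sel [simp]:
  "q1 (quat_cnj p) = q1 p" "qi (quat_cnj p) = - qi p"
  "qj (quat_cnj p) = - qj p" "qk (quat_cnj p) = - qk p"
  by (simp_all add: quat_cnj_def)

lemma quat_mult_sel:
  "q1 (p * q) = q1 p * q1 q - qi p * qi q - qj p * qj q - qk p * qk q"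
  "qi (p * q) = q1 p * qi q + qi p * q1 q + qj p * qk q - qk p * qj q"
  "qj (p * q) = q1 p * qj q - qi p * qk q + qj p * q1 q + qk p * qi q"
  "qk (p * q) = q1 p * qk q + qi p * qj q - qj p * qi q + qk p * q1 q"
  by (simp_all add: quat_defs)

lemma quat_of_real_sel [simp]:
  "q1 (of_real r) = r" "qi (of_real r) = 0" "qj (of_real r) = 0" "qk (of_real r) = 0"
  by (simp_all add: of_real_def)

lemma quat_cnj_simps [simp]:
  "quat_cnj 0 = 0" "quat_cnj 1 = 1" "quat_cnj (quat_cnj p) = p"
  "quat_cnj (p + q) = quat_cnj p + quat_cnj q" "quat_cnj (- p) = - quat_cnj p"
  "quat_cnj (p - q) = quat_cnj p - quat_cnj q"
  "quat_cnj (p * q) = quat_cnj q * quat_cnj p"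
  "quat_cnj (r *\<^sub>R p) = r *\<^sub>R quat_cnj p" "quat_cnj (of_real r) = of_real r"
  by (simp_all add: quat_eq_iff quat_mult_sel algebra_simps)

lemma quat_cnj_sum: "quat_cnj (sum f S) = (\<Sum>x\<in>S. quat_cnj (f x))"
  by (induction S rule: infinite_finite_induct) auto

lemma q1_sum: "q1 (sum f S) = (\<Sum>x\<in>S. q1 (f x))"
  by (induction S rule: infinite_finite_induct) auto

lemma quat_cnj_mult_self: "quat_cnj p * p = of_real (inner p p)"
  by (simp add: quat_eq_iff quat_mult_sel inner_quat_def algebra_simps)

lemma quat_mult_cnj_self: "p * quat_cnj p = of_real (inner p p)"
  by (simp add: quat_eq_iff quat_mult_sel inner_quat_def algebra_simps)

lemma quat_of_real_commute: "of_real r * (p::quat) = p * of_real r"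
  by (simp add: quat_eq_iff quat_mult_sel)

lemma q1_cnj_mult: "q1 (quat_cnj p * q) = inner p q"
  by (simp add: quat_mult_sel inner_quat_def)

text \<open>Left multiplication by \<open>quat_cnj p\<close> replaces \<open>p\<close> by the
  nonzero real number \<open>inner p p\<close>.\<close>

lemma quat_mult_eq_0D:
  fixes p q :: quat
  assumes "p * q = 0" "p \<noteq> 0"
  shows "q = 0"
proof -
  have "inner p p *\<^sub>R q = quat_cnj p * (p * q)"
    by (simp add: mult.assoc [symmetric] quat_cnj_mult_self scaleR_conv_of_real)
  then show ?thesis using assms by simp
qed

section \<open>The quaternion-valued inner product on column vectors\<close>

definition quat_vinner :: "quat^'n \<Rightarrow> quat^'n \<Rightarrow> quat" where
  "quat_vinner x y = (\<Sum>i\<in>UNIV. quat_cnj (x $ i) * y $ i)"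

text \<open>Scalars act from the right so that they commute with matrices, which act from the
  left.\<close>

definition quat_rscale :: "quat^'n \<Rightarrow> quat \<Rightarrow> quat^'n" where
  "quat_rscale x q = (\<chi> i. x $ i * q)"

definition quat_ctranspose :: "quat^'n^'m \<Rightarrow> quat^'m^'n" where
  "quat_ctranspose M = (\<chi> i j. quat_cnj (M $ j $ i))"

lemma quat_vinner_add_right [simp]: "quat_vinner x (y + z) = quat_vinner x y + quat_vinner x z"
  by (simp add: quat_vinner_def distrib_left sum.distrib)

lemma quat_vinner_diff_right [simp]: "quat_vinner x (y - z) = quat_vinner x y - quat_vinner x z"
  by (simp add: quat_vinner_def right_diff_distrib sum_subtractf)

lemma quat_vinner_scaleR_right [simp]: "quat_vinner x (r *\<^sub>R y) = r *\<^sub>R quat_vinner x y"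
  unfolding quat_vinner_def scaleR_right.sum by simp

lemma quat_vinner_scaleR_left [simp]: "quat_vinner (r *\<^sub>R x) y = r *\<^sub>R quat_vinner x y"
  unfolding quat_vinner_def scaleR_right.sum by simp

lemma quat_vinner_rscale_right [simp]: "quat_vinner x (quat_rscale y q) = quat_vinner x y * q"
  by (simp add: quat_vinner_def quat_rscale_def sum_distrib_right mult.assoc)

lemma quat_vinner_rscale_left [simp]:
  "quat_vinner (quat_rscale x q) y = quat_cnj q * quat_vinner x y"
  by (simp add: quat_vinner_def quat_rscale_def sum_distrib_left mult.assoc)

lemma quat_vinner_zero [simp]: "quat_vinner x 0 = 0" "quat_vinner 0 x = 0"
  by (simp_all add: quat_vinner_def)

lemma quat_cnj_vinner: "quat_cnj (quat_vinner x y) = quat_vinner y x"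
  by (simp add: quat_vinner_def quat_cnj_sum)

lemma quat_vinner_eq_0_sym: "quat_vinner x y = 0 \<longleftrightarrow> quat_vinner y x = 0"
  by (metis quat_cnj_vinner quat_cnj_simps(1))

text \<open>Links the quaternion-valued product to the real Euclidean structure, in which the
  extremal arguments take place.\<close>

lemma q1_quat_vinner: "q1 (quat_vinner x y) = inner x y"
  by (simp add: quat_vinner_def q1_sum q1_cnj_mult inner_vec_def)

lemma quat_vinner_self: "quat_vinner x x = of_real (inner x x)"
  by (simp add: quat_vinner_def quat_cnj_mult_self inner_vec_def)

lemma quat_vinner_mult_vec:
  "quat_vinner x (M *v y) = quat_vinner (quat_ctranspose M *v x) y"
proof -
  have "quat_vinner x (M *v y) = (\<Sum>i\<in>UNIV. \<Sum>j\<in>UNIV. quat_cnj (x $ i) * (M $ i $ j * y $ j))"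
    by (simp add: quat_vinner_def matrix_vector_mult_def sum_distrib_left)
  also have "\<dots> = (\<Sum>j\<in>UNIV. \<Sum>i\<in>UNIV. quat_cnj (x $ i) * (M $ i $ j * y $ j))"
    by (rule sum.swap)
  also have "\<dots> = quat_vinner (quat_ctranspose M *v x) y"
    by (simp add: quat_vinner_def matrix_vector_mult_def sum_distrib_right quat_ctranspose_def
        quat_cnj_sum mult.assoc)
  finally show ?thesis .
qed

lemma quat_mult_vec_rscale: "M *v quat_rscale x q = quat_rscale (M *v x) q"
  by (simp add: vec_eq_iff quat_rscale_def matrix_vector_mult_def sum_distrib_right mult.assoc)

lemma quat_mult_vec_scaleR: "M *v (r *\<^sub>R x) = r *\<^sub>R (M *v (x::quat^'n))"
  by (simp add: vec_eq_iff matrix_vector_mult_def scaleR_right.sum)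

lemma linear_quat_mult_vec: "linear (\<lambda>x::quat^'n. M *v x)"
  by (rule linearI) (simp_all add: matrix_vector_right_distrib quat_mult_vec_scaleR)

section \<open>Eigenvectors from maxima of Hermitian forms\<close>

lemma quat_hermitian_form_stationary:
  fixes M :: "quat^'n^'n"
  assumes "quat_ctranspose M = M" "subspace S" "x \<in> S" "y \<in> S"
    and norm: "inner x x = 1"
    and max: "\<And>z. z \<in> S \<Longrightarrow> inner z (M *v z) \<le> inner x (M *v x) * inner z z"
  shows "inner y (M *v x) = inner x (M *v x) * inner y x"
proof -
  define m where "m = inner x (M *v x)"
  define c where "c = inner y (M *v x) - m * inner y x"
  define e where "e = m * inner y y - inner y (M *v y)"
  have sym: "inner x (M *v y) = inner y (M *v x)"
    by (metis assms(1) quat_vinner_mult_vec q1_quat_vinner inner_commute)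
  \<comment> \<open>Comparing \<open>x\<close> with the variation \<open>x + t *\<^sub>R y\<close>
    leaves \<open>2 * c\<close> as first-order and \<open>- e\<close> as second-order coefficient.
    An inequality of this kind for all real \<open>t\<close> forces \<open>c = 0\<close>.\<close>
  have *: "2 * t * c \<le> t\<^sup>2 * e" for t :: real
  proof -
    have "x + t *\<^sub>R y \<in> S" using assms by (simp add: subspace_add subspace_scale)
    from max [OF this] show ?thesis
      using norm sym
      by (simp add: matrix_vector_right_distrib quat_mult_vec_scaleR inner_add_left inner_add_right
          m_def [symmetric] c_def e_def inner_commute [of x y] algebra_simps power2_eq_square)
  qed
  have "c = 0"
  proof (rule ccontr)
    assume "c \<noteq> 0"
    have "0 \<le> e" using * [of 1] * [of "-1"] by simp
    \<comment> \<open>With this \<open>t\<close> the inequality becomes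
      \<open>t\<^sup>2 * (e + 2) \<le> 0\<close>; the summand 1 keeps the denominator positive even
      if \<open>e = 0\<close>.\<close>
    define t where "t = c / (e + 1)"
    have "c = t * (e + 1)" using \<open>0 \<le> e\<close> by (simp add: t_def)
    then have "t\<^sup>2 * (e + 2) \<le> 0"
      using * [of t] by (simp add: algebra_simps power2_eq_square)
    moreover have "t \<noteq> 0" using \<open>c \<noteq> 0\<close> by (simp add: t_def) (use \<open>0 \<le> e\<close> in linarith)
    ultimately show False using \<open>0 \<le> e\<close> by (simp add: mult_le_0_iff)
  qed
  then show ?thesis by (simp add: c_def m_def)
qed

text \<open>A maximizer of the form on the compact unit sphere of \<open>S\<close> works. Testing
  only against \<open>y\<close> in \<open>S\<close> yields an eigenvector of the compression of
  \<open>M\<close> to \<open>S\<close>, so that \<open>S\<close> may fail to be invariant; this is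
  the situation of \<open>B\<close> on an eigenspace of \<open>A\<close>.\<close>

lemma quat_hermitian_compression_eigenvector:
  fixes M :: "quat^'n^'n"
  assumes "quat_ctranspose M = M" "subspace S" "S \<noteq> {0}"
    and rscale: "\<And>x q. x \<in> S \<Longrightarrow> quat_rscale x q \<in> S"
  shows "\<exists>x\<in>S. \<exists>m. inner x x = 1 \<and>
    (\<forall>y\<in>S. quat_vinner y (M *v x) = m *\<^sub>R quat_vinner y x)"
proof -
  let ?K = "S \<inter> sphere 0 1"
  have "compact ?K"
    by (simp add: closed_Int_compact closed_subspace assms)
  obtain z where z: "z \<in> S" "z \<noteq> 0"
    using assms(2,3) subspace_0 by blast
  then have "z /\<^sub>R norm z \<in> ?K" using assms(2) by (simp add: subspace_scale)
  then have "?K \<noteq> {}" by blast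
  have cont: "continuous_on ?K (\<lambda>x. inner x (M *v x))"
    by (intro continuous_intros linear_continuous_on)
      (simp add: linear_conv_bounded_linear [symmetric] linear_quat_mult_vec)
  obtain x where x: "x \<in> ?K" "\<And>y. y \<in> ?K \<Longrightarrow> inner y (M *v y) \<le> inner x (M *v x)"
    using continuous_attains_sup [OF \<open>compact ?K\<close> \<open>?K \<noteq> {}\<close> cont] by blast
  have nx: "inner x x = 1" using x(1) by (simp add: norm_eq_1)
  have max: "inner y (M *v y) \<le> inner x (M *v x) * inner y y" if "y \<in> S" for y
  proof (cases "y = 0")
    case False
    have "y /\<^sub>R norm y \<in> ?K" using that False assms(2) by (simp add: subspace_scale)
    from x(2) [OF this] False show ?thesis
      by (simp add: quat_mult_vec_scaleR dot_square_norm power2_eq_square field_simps)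
  qed simp
  have "quat_vinner y (M *v x) = inner x (M *v x) *\<^sub>R quat_vinner y x" if "y \<in> S" for y
  proof -
    let ?z = "quat_vinner y (M *v x) - inner x (M *v x) *\<^sub>R quat_vinner y x"
    \<comment> \<open>Stationarity controls only real parts. Scaling \<open>y\<close> by the
      discrepancy \<open>?z\<close> turns the discrepancy into \<open>quat_cnj ?z * ?z\<close>,
      whose real part vanishes only if \<open>?z = 0\<close>.\<close>
    let ?y = "quat_rscale y ?z"
    have "inner ?y (M *v x) = inner x (M *v x) * inner ?y x"
      using quat_hermitian_form_stationary [OF assms(1,2) _ rscale [OF that] nx max] x(1) by blast
    then have "q1 (quat_vinner ?y (M *v x) - inner x (M *v x) *\<^sub>R quat_vinner ?y x) = 0"
      by (simp only: quat_sel q1_quat_vinner)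
    also have "quat_vinner ?y (M *v x) - inner x (M *v x) *\<^sub>R quat_vinner ?y x = quat_cnj ?z * ?z"
      by (simp add: right_diff_distrib)
    finally have "inner ?z ?z = 0" by (simp only: quat_cnj_mult_self quat_of_real_sel)
    then show ?thesis by simp
  qed
  then show ?thesis using x(1) nx by blast
qed

text \<open>A real dimension argument: the coordinate \<open>i\<close> of \<open>?T x\<close> is
  always 0, so the endomorphism \<open>?T\<close> is not surjective and hence has a nonzero kernel
  vector.\<close>

lemma quat_nonzero_orthogonal:
  fixes f :: "'n \<Rightarrow> quat^'n"
  assumes "i \<notin> I"
  shows "\<exists>x. x \<noteq> 0 \<and> (\<forall>k\<in>I. quat_vinner (f k) x = 0)"
proof -
  let ?T = "\<lambda>x. (\<chi> k. if k \<in> I then quat_vinner (f k) x else 0) :: quat^'n"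
  have lin: "linear ?T" by (rule linearI) (simp_all add: vec_eq_iff)
  have "\<not> surj ?T"
  proof
    assume "surj ?T"
    then have "(\<chi> k. 1) \<in> range ?T" by simp
    then obtain x where "(\<chi> k. 1) = ?T x" by (rule rangeE)
    then have "(\<chi> k. 1) $ i = ?T x $ i" by (rule arg_cong)
    then show False using assms by simp
  qed
  then have "\<not> inj ?T" using linear_injective_imp_surjective lin by blast
  then obtain x where "x \<noteq> 0" "?T x = 0" using linear_injective_0 [OF lin] by blast
  then have "quat_vinner (f k) x = 0" if "k \<in> I" for k
    using that by (simp add: vec_eq_iff) metis
  with \<open>x \<noteq> 0\<close> show ?thesis by blast
qed

text \<open>Diagonalizing \<open>A + B\<epsilon>\<close> to first order requires an eigenbasis of \<open>A\<close> that is adapted to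
  the compression of \<open>B\<close> to each eigenspace of \<open>A\<close>. The statement about all further \<open>y\<close> keeps
  this property extensible in the induction.\<close>

lemma quat_hermitian_adapted_partial_eigenbasis:
  fixes A B :: "quat^'n^'n"
  assumes A: "quat_ctranspose A = A" and B: "quat_ctranspose B = B" and "finite I"
  shows "\<exists>(f :: 'n \<Rightarrow> quat^'n) (d :: 'n \<Rightarrow> real).
    (\<forall>i\<in>I. \<forall>j\<in>I. quat_vinner (f i) (f j) = (if i = j then 1 else 0)) \<and>
    (\<forall>i\<in>I. A *v f i = d i *\<^sub>R f i) \<and>
    (\<forall>i\<in>I. \<forall>j\<in>I. i \<noteq> j \<longrightarrow> d i = d j \<longrightarrow> quat_vinner (f i) (B *v f j) = 0) \<and>
    (\<forall>j\<in>I. \<forall>y. (\<forall>k\<in>I. quat_vinner (f k) y = 0) \<longrightarrow> A *v y = d j *\<^sub>R y \<longrightarrow>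
      quat_vinner y (B *v f j) = 0)"
  using \<open>finite I\<close>
proof (induction I rule: finite_induct)
  case (insert i I)
  from insert.IH obtain f :: "'n \<Rightarrow> quat^'n" and d :: "'n \<Rightarrow> real" where IH:
    "\<forall>i\<in>I. \<forall>j\<in>I. quat_vinner (f i) (f j) = (if i = j then 1 else 0)"
    "\<forall>i\<in>I. A *v f i = d i *\<^sub>R f i"
    "\<forall>i\<in>I. \<forall>j\<in>I. i \<noteq> j \<longrightarrow> d i = d j \<longrightarrow> quat_vinner (f i) (B *v f j) = 0"
    "\<forall>j\<in>I. \<forall>y. (\<forall>k\<in>I. quat_vinner (f k) y = 0) \<longrightarrow> A *v y = d j *\<^sub>R y \<longrightarrow>
      quat_vinner y (B *v f j) = 0"
    by (elim exE conjE)
  note on = IH(1) [rule_format] and ev = IH(2) [rule_format] and off = IH(3) [rule_format]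
    and ext = IH(4) [rule_format]
  define S where "S = {x. \<forall>k\<in>I. quat_vinner (f k) x = 0}"
  have S: "subspace S" by (auto simp: S_def subspace_def)
  have SR: "quat_rscale x q \<in> S" if "x \<in> S" for x q using that by (auto simp: S_def)
  have "S \<noteq> {0}"
    using quat_nonzero_orthogonal [OF \<open>i \<notin> I\<close>, of f] unfolding S_def by blast
  from quat_hermitian_compression_eigenvector [OF A S this SR]
  obtain x0 m where x0: "x0 \<in> S" "inner x0 x0 = 1"
    "\<And>y. y \<in> S \<Longrightarrow> quat_vinner y (A *v x0) = m *\<^sub>R quat_vinner y x0"
    by blast
  \<comment> \<open>The orthogonal complement \<open>S\<close> of the earlier eigenvectors is
    invariant under \<open>A\<close>, so the residual \<open>?z\<close> lies in \<open>S\<close> and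
    may be used as test vector against itself.\<close>
  have ev0: "A *v x0 = m *\<^sub>R x0"
  proof -
    let ?z = "A *v x0 - m *\<^sub>R x0"
    have "quat_vinner (f k) (A *v x0) = 0" if "k \<in> I" for k
      using that x0(1) by (simp add: quat_vinner_mult_vec A ev S_def)
    then have "?z \<in> S" using x0(1) by (simp add: S_def)
    from x0(3) [OF this] have "quat_vinner ?z ?z = 0" by simp
    then have "inner ?z ?z = 0" by (metis q1_quat_vinner quat_sel(1))
    then show ?thesis by simp
  qed
  \<comment> \<open>\<open>x0\<close> only serves to supply an eigenvalue \<open>m\<close> with
    nonzero eigenspace in \<open>S\<close>. The new basis vector is then chosen in that eigenspace
    by maximizing the form of \<open>B\<close>.\<close>
  define E where "E = {x \<in> S. A *v x = m *\<^sub>R x}"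
  have E: "subspace E"
    using S by (auto simp: E_def subspace_def matrix_vector_right_distrib quat_mult_vec_scaleR
        scaleR_add_right)
  have ER: "quat_rscale x q \<in> E" if "x \<in> E" for x q
    using that SR by (simp add: E_def quat_mult_vec_rscale) (simp add: quat_rscale_def vec_eq_iff)
  have "x0 \<in> E" "x0 \<noteq> 0" using x0(1,2) ev0 by (auto simp: E_def)
  then have "E \<noteq> {0}" by blast
  from quat_hermitian_compression_eigenvector [OF B E this ER]
  obtain x b where x: "x \<in> E" "inner x x = 1"
    "\<And>y. y \<in> E \<Longrightarrow> quat_vinner y (B *v x) = b *\<^sub>R quat_vinner y x"
    by blast
  have xf: "quat_vinner (f k) x = 0" "quat_vinner x (f k) = 0" if "k \<in> I" for k
    using that x(1) quat_vinner_eq_0_sym [of "f k" x] by (auto simp: E_def S_def)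
  have xx: "quat_vinner x x = 1" using x(2) by (simp add: quat_vinner_self)
  \<comment> \<open>Here the extensibility clause of the induction hypothesis is applied to
    \<open>x\<close>, which is orthogonal to the earlier vectors and belongs to the eigenvalue
    \<open>d k\<close>.\<close>
  have xB: "quat_vinner x (B *v f k) = 0" "quat_vinner (f k) (B *v x) = 0"
    if "k \<in> I" "m = d k" for k
  proof -
    show "quat_vinner x (B *v f k) = 0"
      using that x(1) xf by (intro ext) (auto simp: E_def)
    then show "quat_vinner (f k) (B *v x) = 0"
      by (metis B quat_vinner_mult_vec quat_vinner_eq_0_sym)
  qed
  \<comment> \<open>The extensibility clause for the new vector: such a \<open>y\<close> lies in
    \<open>E\<close>, where \<open>x\<close> is an eigenvector of the compressed \<open>B\<close>,
    and \<open>y\<close> is orthogonal to \<open>x\<close>.\<close>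
  have yB: "quat_vinner y (B *v x) = 0"
    if "\<And>k. k \<in> I \<Longrightarrow> quat_vinner (f k) y = 0" "quat_vinner x y = 0" "A *v y = m *\<^sub>R y" for y
    using x(3) [of y] that quat_vinner_eq_0_sym [of x y] by (auto simp: E_def S_def)
  have neq: "k \<noteq> i" if "k \<in> I" for k using that insert.hyps by blast
  show ?case
  proof (intro exI [of _ "f(i := x)"] exI [of _ "d(i := m)"] conjI ballI allI impI)
    fix j k assume "j \<in> insert i I" "k \<in> insert i I"
    then show "quat_vinner ((f(i := x)) j) ((f(i := x)) k) = (if j = k then 1 else 0)"
      using on xx xf neq by auto
  next
    fix j assume "j \<in> insert i I"
    then show "A *v (f(i := x)) j = (d(i := m)) j *\<^sub>R (f(i := x)) j"
      using ev x(1) by (auto simp: E_def)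
  next
    fix j k assume "j \<in> insert i I" "k \<in> insert i I" "j \<noteq> k" "(d(i := m)) j = (d(i := m)) k"
    then show "quat_vinner ((f(i := x)) j) (B *v (f(i := x)) k) = 0"
      using off xB neq by (auto split: if_splits)
  next
    fix j y assume "j \<in> insert i I" "\<forall>k\<in>insert i I. quat_vinner ((f(i := x)) k) y = 0"
      and Ay: "A *v y = (d(i := m)) j *\<^sub>R y"
    then have "\<And>k. k \<in> I \<Longrightarrow> quat_vinner (f k) y = 0" "quat_vinner x y = 0"
      using neq by (metis insertI2 fun_upd_other, metis insertI1 fun_upd_same)
    then show "quat_vinner y (B *v (f(i := x)) j) = 0"
      using \<open>j \<in> insert i I\<close> Ay ext yB by (cases "j = i") auto
  qed
qed simp

section \<open>Adjoints and inverses of quaternion matrices\<close>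

lemma quat_ctranspose_mult:
  "quat_ctranspose (M ** N) = quat_ctranspose N ** quat_ctranspose M"
  by (simp only: vec_eq_iff quat_ctranspose_def matrix_matrix_mult_def vec_lambda_beta
      quat_cnj_sum quat_cnj_simps simp_thms)

text \<open>A left inverse makes \<open>U\<close> injective and, by finite real dimension,
  surjective; on a vector \<open>U *v x\<close> the product \<open>U ** V\<close> clearly acts as
  the identity.\<close>

lemma quat_matrix_left_inverse_imp_right:
  fixes U V :: "quat^'n^'n"
  assumes "V ** U = mat 1"
  shows "U ** V = mat 1"
proof -
  have "inj (\<lambda>x. U *v x)"
    by (rule inj_on_inverseI [of _ "\<lambda>x. V *v x"]) (simp add: matrix_vector_mul_assoc assms)
  then have surj: "surj (\<lambda>x. U *v x)"
    using linear_injective_imp_surjective linear_quat_mult_vec by blast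
  have "(U ** V) *v y = y" for y
  proof -
    obtain x where "y = U *v x" using surj by (metis surjD)
    then show ?thesis
      by (simp add: matrix_vector_mul_assoc assms matrix_mul_assoc [symmetric])
  qed
  then have "((U ** V) *v axis j 1) $ i = axis j 1 $ i" for i j by simp
  then show ?thesis
    by (simp add: vec_eq_iff mat_def matrix_vector_mult_def axis_def if_distrib [of "\<lambda>x. _ * x"]
        cong: if_cong)
qed

section \<open>Diagonalization of Hermitian dual quaternion matrices\<close>

lemma dual_part_simps [simp]:
  fixes p q :: "'a::ring_1 dual_over"
  shows "st_part (0 :: 'a dual_over) = 0" "eps_part (0 :: 'a dual_over) = 0"
    "st_part (1 :: 'a dual_over) = 1" "eps_part (1 :: 'a dual_over) = 0"
    "st_part (p + q) = st_part p + st_part q" "eps_part (p + q) = eps_part p + eps_part q"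
    "st_part (- p) = - st_part p" "eps_part (- p) = - eps_part p"
    "st_part (p - q) = st_part p - st_part q" "eps_part (p - q) = eps_part p - eps_part q"
    "st_part (p * q) = st_part p * st_part q"
    "eps_part (p * q) = st_part p * eps_part q + eps_part p * st_part q"
  by (simp_all add: zero_dual_over_def one_dual_over_def plus_dual_over_def
      uminus_dual_over_def minus_dual_over_def times_dual_over_def)

lemma st_part_sum: "st_part (sum f S) = (\<Sum>x\<in>S. st_part (f x :: 'a::ring_1 dual_over))"
  by (induction S rule: infinite_finite_induct) auto

lemma eps_part_sum: "eps_part (sum f S) = (\<Sum>x\<in>S. eps_part (f x :: 'a::ring_1 dual_over))"
  by (induction S rule: infinite_finite_induct) auto

lemma dq_cnj_simps [simp]:
  "st_part (dq_cnj p) = quat_cnj (st_part p)" "eps_part (dq_cnj p) = quat_cnj (eps_part p)"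
  "dq_cnj 0 = 0" "dq_cnj 1 = 1" "dq_cnj (dq_cnj p) = p" "dq_cnj (p + q) = dq_cnj p + dq_cnj q"
  "dq_cnj (p * q) = dq_cnj q * dq_cnj p"
  by (simp_all add: dq_cnj_def dual_eq_iff)

lemma dq_cnj_sum: "dq_cnj (sum f S) = (\<Sum>x\<in>S. dq_cnj (f x))"
  by (induction S rule: infinite_finite_induct) auto

lemma dq_of_dual_simps [simp]:
  "st_part (dq_of_dual p) = of_real (st_part p)" "eps_part (dq_of_dual p) = of_real (eps_part p)"
  "dq_of_dual 0 = 0" "dq_of_dual 1 = 1" "dq_of_dual (p + q) = dq_of_dual p + dq_of_dual q"
  "dq_of_dual (p * q) = dq_of_dual p * dq_of_dual q"
  by (simp_all add: dq_of_dual_def dual_eq_iff)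

lemma dq_of_dual_sum: "dq_of_dual (sum f S) = (\<Sum>x\<in>S. dq_of_dual (f x))"
  by (induction S rule: infinite_finite_induct) auto

lemma dq_of_dual_inject [simp]: "dq_of_dual p = dq_of_dual q \<longleftrightarrow> p = q"
  by (auto simp: dual_eq_iff)

lemma dq_of_dual_commute: "dq_of_dual p * q = q * dq_of_dual p"
  by (simp add: dual_eq_iff quat_of_real_commute add.commute)

lemma ctranspose_mult: "ctranspose (M ** N) = ctranspose N ** ctranspose M"
  by (simp only: vec_eq_iff ctranspose_def matrix_matrix_mult_def vec_lambda_beta
      dq_cnj_sum dq_cnj_simps simp_thms)

lemma ctranspose_ctranspose [simp]: "ctranspose (ctranspose M) = M"
  by (simp add: vec_eq_iff ctranspose_def)

text \<open>The matrix \<open>M + N \<epsilon>\<close>. In this form an identity of dual quaternion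
  matrices splits into two identities of quaternion matrices.\<close>

definition dual_mat :: "quat^'n^'m \<Rightarrow> quat^'n^'m \<Rightarrow> dual_quat^'n^'m" where
  "dual_mat M N = (\<chi> i j. Dual (M $ i $ j) (N $ i $ j))"

lemma dual_mat_inject [simp]: "dual_mat M N = dual_mat M' N' \<longleftrightarrow> M = M' \<and> N = N'"
  by (auto simp add: dual_mat_def vec_eq_iff)

lemma dual_mat_cases: obtains M N where "A = dual_mat M N"
proof
  show "A = dual_mat (\<chi> i j. st_part (A $ i $ j)) (\<chi> i j. eps_part (A $ i $ j))"
    by (simp add: dual_mat_def vec_eq_iff)
qed

lemma ctranspose_dual_mat:
  "ctranspose (dual_mat M N) = dual_mat (quat_ctranspose M) (quat_ctranspose N)"
  by (simp add: dual_mat_def ctranspose_def quat_ctranspose_def vec_eq_iff dq_cnj_def)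

lemma mat_1_dual_mat: "mat 1 = dual_mat (mat 1) 0"
  by (simp add: dual_mat_def mat_def vec_eq_iff dual_eq_iff)

lemma dual_mat_mult: "dual_mat M N ** dual_mat M' N' = dual_mat (M ** M') (M ** N' + N ** M')"
proof -
  have "(dual_mat M N ** dual_mat M' N') $ i $ j =
    dual_mat (M ** M') (M ** N' + N ** M') $ i $ j" for i j
    by (simp add: dual_eq_iff dual_mat_def matrix_matrix_mult_def st_part_sum eps_part_sum
        sum.distrib)
  then show ?thesis by (simp only: vec_eq_iff) simp
qed

lemma matrix_add_rdistrib: "(A + B) ** C = A ** C + B ** (C :: 'a::semiring_1^_^_)"
  by (vector matrix_matrix_mult_def sum.distrib [symmetric] distrib_right)

text \<open>The standard part is the quaternion case. The infinitesimal part of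
  \<open>U\<^sup>* U = I\<close>, multiplied by \<open>P\<close> on the left and by
  \<open>P\<^sup>*\<close> on the right, becomes that of \<open>U U\<^sup>* = I\<close>.\<close>

lemma dq_unitary_right:
  assumes "dq_unitary U"
  shows "U ** ctranspose U = mat 1"
proof -
  obtain P Q where U: "U = dual_mat P Q" by (rule dual_mat_cases)
  let ?P = "quat_ctranspose P" and ?Q = "quat_ctranspose Q"
  have PP: "?P ** P = mat 1" and PQ: "?P ** Q + ?Q ** P = 0"
    using assms by (simp_all add: dq_unitary_def U ctranspose_dual_mat dual_mat_mult mat_1_dual_mat)
  have PP': "P ** ?P = mat 1" by (rule quat_matrix_left_inverse_imp_right [OF PP])
  have "P ** (?P ** Q + ?Q ** P) ** ?P = (P ** ?P) ** Q ** ?P + P ** ?Q ** (P ** ?P)"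
    by (simp only: matrix_add_ldistrib matrix_add_rdistrib matrix_mul_assoc)
  then have "P ** ?Q + Q ** ?P = 0" by (simp add: PQ PP' add.commute)
  then show ?thesis
    by (simp add: U ctranspose_dual_mat dual_mat_mult mat_1_dual_mat PP')
qed

text \<open>The factor \<open>I + S\<epsilon>\<close> with \<open>S\<close> anti-Hermitian is unitary and changes the infinitesimal part
  \<open>B\<close> of \<open>D + B\<epsilon>\<close> by the commutator of \<open>D\<close> and \<open>S\<close>. This removes all entries of \<open>B\<close> between
  different eigenvalues of \<open>D\<close>; the choice of the eigenbasis takes care of the others.\<close>

lemma dq_hermitian_diagonalizable:
  fixes A :: "dual_quat^'n^'n"
  assumes "dq_hermitian A"
  shows "\<exists>U d. diagonalizes U A d"
proof -
  obtain A0 A1 where A: "A = dual_mat A0 A1" by (rule dual_mat_cases)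
  have herm: "quat_ctranspose A0 = A0" "quat_ctranspose A1 = A1"
    using assms by (simp_all add: dq_hermitian_def A ctranspose_dual_mat)
  obtain f :: "'n \<Rightarrow> quat^'n" and d :: "'n \<Rightarrow> real"
    where on: "\<forall>i j. quat_vinner (f i) (f j) = (if i = j then 1 else 0)"
      and ev: "\<forall>i. A0 *v f i = d i *\<^sub>R f i"
      and off: "\<forall>i j. i \<noteq> j \<longrightarrow> d i = d j \<longrightarrow> quat_vinner (f i) (A1 *v f j) = 0"
    using quat_hermitian_adapted_partial_eigenbasis [OF herm finite [of UNIV]] by (elim exE conjE) simp
  define P :: "quat^'n^'n" where "P = (\<chi> k i. f i $ k)"
  define D :: "quat^'n^'n" where "D = (\<chi> i j. if i = j then of_real (d i) else 0)"
  define b where "b i j = quat_vinner (f i) (A1 *v f j)" for i j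
  \<comment> \<open>Off the eigenspaces \<open>S\<close> solves
    \<open>d i *\<^sub>R S $ i $ j + b i j = d j *\<^sub>R S $ i $ j\<close>. Where
    \<open>d i = d j\<close> the entry 0 suffices, as there \<open>b i j\<close> vanishes unless
    \<open>i = j\<close>.\<close>
  define S :: "quat^'n^'n"
    where "S = (\<chi> i j. if d i = d j then 0 else inverse (d j - d i) *\<^sub>R b i j)"
  let ?P = "quat_ctranspose P" and ?S = "quat_ctranspose S"
  have PMP: "?P ** (M ** P) = (\<chi> i j. quat_vinner (f i) (M *v f j))" for M
    by (simp add: vec_eq_iff quat_ctranspose_def P_def matrix_matrix_mult_def quat_vinner_def
        matrix_vector_mult_def)
  have PP: "?P ** P = mat 1"
    using PMP [of "mat 1"] by (simp add: on) (simp add: mat_def)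
  have PAP: "?P ** A0 ** P = D"
    using PMP [of A0] by (simp add: ev on matrix_mul_assoc) (simp add: D_def vec_eq_iff of_real_def)
  have PBP: "?P ** A1 ** P = (\<chi> i j. b i j)"
    using PMP [of A1] by (simp add: b_def matrix_mul_assoc)
  have bcnj: "quat_cnj (b i j) = b j i" for i j
    by (simp add: b_def quat_cnj_vinner) (simp add: quat_vinner_mult_vec herm)
  \<comment> \<open>Exchanging \<open>i\<close> and \<open>j\<close> conjugates \<open>b i j\<close>
    and flips the sign of the real factor \<open>inverse (d j - d i)\<close>.\<close>
  have anti: "S + ?S = 0"
    by (auto simp: vec_eq_iff S_def quat_ctranspose_def bcnj scaleR_add_left [symmetric]
        divide_simps)
  have Dij: "D $ i $ j = (if i = j then of_real (d i) else 0)" for i j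
    by (simp add: D_def)
  have DS: "(D ** S) $ i $ j = d i *\<^sub>R S $ i $ j" for i j
    by (simp add: matrix_matrix_mult_def D_def if_distrib [of "\<lambda>x. x * _"] scaleR_conv_of_real
        cong: if_cong)
  have SD: "(?S ** D) $ i $ j = d j *\<^sub>R ?S $ i $ j" for i j
    by (simp add: matrix_matrix_mult_def D_def if_distrib [of "\<lambda>x. _ * x"] scaleR_conv_of_real
        quat_of_real_commute cong: if_cong)
  have S': "?S $ i $ j = - S $ i $ j" for i j
    using anti by (simp add: vec_eq_iff add_eq_0_iff)
  \<comment> \<open>This is \<open>P (I + S \<epsilon>)\<close>; the infinitesimal part of
    \<open>U\<^sup>* U\<close> is therefore \<open>S + ?S\<close>.\<close>
  define U where "U = dual_mat P (P ** S)"
  \<comment> \<open>Taking \<open>q1\<close> loses nothing: \<open>b i i\<close> equals its own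
    conjugate and so is real.\<close>
  define l where "l i = Dual (d i) (q1 (b i i))" for i
  have U': "ctranspose U = dual_mat ?P (?S ** ?P)"
    by (simp add: U_def ctranspose_dual_mat quat_ctranspose_mult)
  have "?P ** (P ** S) + ?S ** ?P ** P = (?P ** P) ** S + ?S ** (?P ** P)"
    by (simp only: matrix_mul_assoc)
  then have "dq_unitary U"
    unfolding dq_unitary_def U'
    by (simp add: U_def dual_mat_mult PP anti mat_1_dual_mat)
  moreover have "ctranspose U ** A ** U = dual_diag l"
  proof -
    have "?P ** A0 ** (P ** S) + (?P ** A1 + ?S ** ?P ** A0) ** P =
      (?P ** A0 ** P) ** S + (?P ** A1 ** P) + ?S ** (?P ** A0 ** P)"
      by (simp only: matrix_mul_assoc matrix_add_rdistrib add.assoc)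
    also have "\<dots> = D ** S + (\<chi> i j. b i j) + ?S ** D"
      by (simp only: PAP PBP)
    finally have *: "ctranspose U ** A ** U = dual_mat D (D ** S + (\<chi> i j. b i j) + ?S ** D)"
      unfolding U' by (simp add: U_def A dual_mat_mult PAP)
    have "dual_mat D (D ** S + (\<chi> i j. b i j) + ?S ** D) $ i $ j = dual_diag l $ i $ j" for i j
    proof (cases "i = j")
      case True
      have "b i i = of_real (q1 (b i i))"
        using bcnj [of i i] by (simp add: quat_eq_iff)
      then show ?thesis
        using True by (simp add: dual_mat_def dual_diag_def l_def dual_eq_iff DS SD S' Dij)
    next
      case False
      have "d i *\<^sub>R S $ i $ j + b i j - d j *\<^sub>R S $ i $ j = 0"
      proof (cases "d i = d j")
        case True
        then show ?thesis using False off by (simp add: b_def)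
      next
        case False
        then have "S $ i $ j = inverse (d j - d i) *\<^sub>R b i j" by (simp add: S_def)
        then have "(d j - d i) *\<^sub>R S $ i $ j = b i j" using False by simp
        then show ?thesis by (simp add: algebra_simps)
      qed
      then show ?thesis
        using False by (simp add: dual_mat_def dual_diag_def dual_eq_iff DS SD S' Dij)
    qed
    then show ?thesis unfolding * by (simp only: vec_eq_iff) simp
  qed
  ultimately show ?thesis unfolding diagonalizes_def by blast
qed

section \<open>Eigenvalues and quadratic forms\<close>

lemma diagonalizes_imp_mult:
  assumes "diagonalizes U A d"
  shows "A ** U = U ** dual_diag d"
proof -
  have "A ** U = U ** ctranspose U ** (A ** U)"
    using assms by (simp add: diagonalizes_def dq_unitary_right)
  also have "\<dots> = U ** (ctranspose U ** A ** U)"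
    by (simp only: matrix_mul_assoc)
  finally show ?thesis using assms by (simp add: diagonalizes_def)
qed

lemma diagonalizes_imp_eq:
  assumes "diagonalizes U A d"
  shows "A = U ** dual_diag d ** ctranspose U"
proof -
  have "A = A ** (U ** ctranspose U)"
    using assms by (simp add: diagonalizes_def dq_unitary_right)
  also have "\<dots> = (A ** U) ** ctranspose U"
    by (simp only: matrix_mul_assoc)
  finally show ?thesis using diagonalizes_imp_mult [OF assms] by simp
qed

lemma dual_diag_mult_vec: "(dual_diag d *v y) $ i = dq_of_dual (d i) * y $ i"
  by (simp add: dual_diag_def matrix_vector_mult_def if_distrib [of "\<lambda>x. x * _"] cong: if_cong)

lemma dual_diag_mult: "(dual_diag d ** W) $ i $ j = dq_of_dual (d i) * W $ i $ j"
  by (simp add: dual_diag_def matrix_matrix_mult_def if_distrib [of "\<lambda>x. x * _"] cong: if_cong)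

lemma mult_dual_diag: "(W ** dual_diag d) $ i $ j = W $ i $ j * dq_of_dual (d j)"
  by (simp add: dual_diag_def matrix_matrix_mult_def if_distrib [of "\<lambda>x. _ * x"] cong: if_cong)

lemma mult_column: "M *v column i N = column i (M ** N)"
  by (simp add: column_def matrix_vector_mult_def matrix_matrix_mult_def)

lemma appreciable_vec_mult:
  assumes "appreciable_vec (M *v y)"
  shows "appreciable_vec y"
proof (rule ccontr)
  assume "\<not> appreciable_vec y"
  then have "st_part ((M *v y) $ i) = 0" for i
    by (simp add: appreciable_vec_def appreciable_def matrix_vector_mult_def st_part_sum)
  then show False using assms by (simp add: appreciable_vec_def appreciable_def)
qed

lemma diagonalizes_eigenvector:
  assumes "diagonalizes U A d"
  shows "dq_eigenvector A (d i) (column i U)"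
proof -
  \<comment> \<open>The image of the column under \<open>U\<^sup>*\<close> is a standard basis
    vector; its appreciability passes back to the column.\<close>
  have "ctranspose U *v column i U = column i (mat 1)"
    using assms by (simp add: mult_column diagonalizes_def dq_unitary_def)
  then have "st_part ((ctranspose U *v column i U) $ i) \<noteq> 0"
    by (simp add: column_def mat_def)
  then have "appreciable_vec (ctranspose U *v column i U)"
    by (auto simp: appreciable_vec_def appreciable_def)
  then have "appreciable_vec (column i U)" by (rule appreciable_vec_mult)
  moreover have "A *v column i U = vec_mult_right (column i U) (dq_of_dual (d i))"
    by (simp add: mult_column diagonalizes_imp_mult [OF assms])
      (simp add: column_def vec_mult_right_def mult_dual_diag)
  ultimately show ?thesis by (simp add: dq_eigenvector_def)
qed

text \<open>Dual quaternions have zero divisors, but appreciable factors cancel: first in the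
  standard part, and then, with \<open>st_part q = 0\<close>, in the infinitesimal part.\<close>

lemma dq_mult_eq_0D:
  fixes p q :: dual_quat
  assumes "p * q = 0" "appreciable p"
  shows "q = 0"
proof -
  have p: "st_part p \<noteq> 0" using assms(2) by (simp add: appreciable_def)
  have "st_part p * st_part q = 0" using arg_cong [OF assms(1), of st_part] by simp
  then have st: "st_part q = 0" using p by (rule quat_mult_eq_0D)
  then have "st_part p * eps_part q = 0" using arg_cong [OF assms(1), of eps_part] by simp
  then have "eps_part q = 0" using p by (rule quat_mult_eq_0D)
  with st show ?thesis by (simp add: dual_eq_iff)
qed

lemma appreciable_vec_unitary_mult:
  assumes "dq_unitary U" "appreciable_vec x"
  shows "appreciable_vec (ctranspose U *v x)"
proof (rule appreciable_vec_mult)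
  show "appreciable_vec (U *v (ctranspose U *v x))"
    using assms by (simp add: matrix_vector_mul_assoc dq_unitary_right)
qed

lemma vec_mult_right_mult: "M *v vec_mult_right x l = vec_mult_right (M *v x) l"
proof -
  have "(M *v vec_mult_right x l) $ i = vec_mult_right (M *v x) l $ i" for i
    by (simp add: vec_mult_right_def matrix_vector_mult_def sum_distrib_right mult.assoc)
  then show ?thesis by (simp only: vec_eq_iff) simp
qed

lemma right_eigenvalue_iff:
  assumes "diagonalizes U A d"
  shows "right_eigenvalue A l \<longleftrightarrow> (\<exists>i. l = dq_of_dual (d i))"
proof
  assume "right_eigenvalue A l"
  then obtain x where x: "appreciable_vec x" "A *v x = vec_mult_right x l"
    by (auto simp: right_eigenvalue_def)
  define y where "y = ctranspose U *v x"
  have U: "dq_unitary U" using assms by (simp add: diagonalizes_def)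
  have "appreciable_vec y"
    unfolding y_def using U x(1) by (rule appreciable_vec_unitary_mult)
  then obtain i where i: "appreciable (y $ i)" by (auto simp: appreciable_vec_def)
  have "dual_diag d *v y = ctranspose U ** (A ** (U ** ctranspose U)) *v x"
    using assms by (simp add: y_def matrix_vector_mul_assoc diagonalizes_def matrix_mul_assoc)
  also have "\<dots> = ctranspose U *v (A *v x)"
    using dq_unitary_right [OF U] by (simp add: matrix_vector_mul_assoc)
  also have "\<dots> = vec_mult_right y l"
    by (simp add: x(2) vec_mult_right_mult y_def)
  finally have "(dual_diag d *v y) $ i = vec_mult_right y l $ i" by simp
  \<comment> \<open>Dual numbers are central, so \<open>d i\<close> can be moved to the right and
    the appreciable \<open>y $ i\<close> cancelled on the left. Hence an arbitrary right eigenvalue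
    \<open>l\<close> is seen to be a dual number.\<close>
  then have "y $ i * dq_of_dual (d i) = y $ i * l"
    by (simp add: dual_diag_mult_vec vec_mult_right_def dq_of_dual_commute)
  then have "y $ i * (l - dq_of_dual (d i)) = 0" by (simp add: right_diff_distrib)
  then have "l - dq_of_dual (d i) = 0" using i by (rule dq_mult_eq_0D)
  then show "\<exists>i. l = dq_of_dual (d i)" by auto
next
  assume "\<exists>i. l = dq_of_dual (d i)"
  then show "right_eigenvalue A l"
    using diagonalizes_eigenvector [OF assms] by (auto simp: dq_eigenvector_def right_eigenvalue_def)
qed

text \<open>For two diagonalizing matrices \<open>U\<close> and \<open>V\<close>, the squared moduli of the standard parts of
  the entries of \<open>U\<^sup>*V\<close> form a doubly stochastic matrix which only couples equal diagonal
  entries; double counting then gives equal multiplicities.\<close>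

lemma diagonalizes_unique:
  assumes U: "diagonalizes U A d" and V: "diagonalizes V A d'"
  shows "image_mset d (mset_set UNIV) = image_mset d' (mset_set UNIV)"
proof (rule multiset_eqI)
  fix l
  define W where "W = ctranspose U ** V"
  define w where "w i j = inner (st_part (W $ i $ j)) (st_part (W $ i $ j))" for i j
  have uni: "ctranspose U ** U = mat 1" "ctranspose V ** V = mat 1"
    "U ** ctranspose U = mat 1" "V ** ctranspose V = mat 1"
    using U V dq_unitary_right by (auto simp: diagonalizes_def dq_unitary_def)
  have WW: "ctranspose W ** W = mat 1"
  proof -
    have "ctranspose W ** W = ctranspose V ** (U ** ctranspose U) ** V"
      by (simp only: W_def ctranspose_mult ctranspose_ctranspose matrix_mul_assoc)
    then show ?thesis by (simp add: uni)
  qed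
  \<comment> \<open>The column sums of \<open>w\<close> come from \<open>W\<^sup>* W = I\<close>,
    the row sums from this identity.\<close>
  then have WW': "W ** ctranspose W = mat 1" by (simp add: dq_unitary_right dq_unitary_def)
  have "dual_diag d ** W = W ** dual_diag d'"
  proof -
    have "dual_diag d ** W = ctranspose U ** (A ** (U ** ctranspose U)) ** V"
      using U by (simp add: W_def diagonalizes_def matrix_mul_assoc)
    also have "\<dots> = ctranspose U ** (A ** V)" by (simp add: uni matrix_mul_assoc)
    also have "\<dots> = W ** dual_diag d'"
      by (simp add: diagonalizes_imp_mult [OF V] W_def matrix_mul_assoc)
    finally show ?thesis .
  qed
  then have "W $ i $ j * dq_of_dual (d i) = W $ i $ j * dq_of_dual (d' j)" for i j
    by (metis dual_diag_mult mult_dual_diag dq_of_dual_commute)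
  then have eq: "W $ i $ j * (dq_of_dual (d i) - dq_of_dual (d' j)) = 0" for i j
    by (simp add: right_diff_distrib)
  have supp: "w i j = 0" if "d i \<noteq> d' j" for i j
  proof (rule ccontr)
    assume "w i j \<noteq> 0"
    then have "appreciable (W $ i $ j)" by (auto simp: w_def appreciable_def)
    then have "dq_of_dual (d i) - dq_of_dual (d' j) = 0" by (rule dq_mult_eq_0D [OF eq])
    then show False using that by simp
  qed
  have col: "(\<Sum>i\<in>UNIV. w i j) = 1" for j
  proof -
    have "q1 (st_part ((ctranspose W ** W) $ j $ j)) = (\<Sum>i\<in>UNIV. w i j)"
      by (simp add: ctranspose_def matrix_matrix_mult_def st_part_sum q1_sum w_def q1_cnj_mult)
    then show ?thesis by (simp add: WW mat_def)
  qed
  have row: "(\<Sum>j\<in>UNIV. w i j) = 1" for i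
  proof -
    have "q1 (st_part ((W ** ctranspose W) $ i $ i)) = (\<Sum>j\<in>UNIV. w i j)"
      by (simp add: ctranspose_def matrix_matrix_mult_def st_part_sum q1_sum w_def
          quat_mult_cnj_self)
    then show ?thesis by (simp add: WW' mat_def)
  qed
  let ?I = "{i. d i = l}" and ?J = "{j. d' j = l}"
  have "real (card ?I) = (\<Sum>i\<in>?I. \<Sum>j\<in>UNIV. w i j)" by (simp add: row)
  also have "\<dots> = (\<Sum>i\<in>?I. \<Sum>j\<in>?J. w i j)"
    by (intro sum.cong refl sum.mono_neutral_right) (auto intro: supp)
  also have "\<dots> = (\<Sum>j\<in>?J. \<Sum>i\<in>?I. w i j)" by (rule sum.swap)
  also have "\<dots> = (\<Sum>j\<in>?J. \<Sum>i\<in>UNIV. w i j)"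
    by (intro sum.cong refl sum.mono_neutral_left) (auto intro: supp)
  also have "\<dots> = real (card ?J)" by (simp add: col)
  finally have "card ?I = card ?J" by simp
  then show "count (image_mset d (mset_set UNIV)) l = count (image_mset d' (mset_set UNIV)) l"
    by (simp add: count_image_mset vimage_def eq_commute)
qed

text \<open>The squared modulus \<open>q\<^sup>* q\<close> as a dual number; its infinitesimal part
  is the derivative of the squared norm at \<open>st_part q\<close> in direction
  \<open>eps_part q\<close>.\<close>

definition dq_norm_sq :: "dual_quat \<Rightarrow> dual_number" where
  "dq_norm_sq q = Dual (inner (st_part q) (st_part q)) (2 * inner (st_part q) (eps_part q))"

lemma dq_cnj_mult_self: "dq_cnj q * q = dq_of_dual (dq_norm_sq q)"
proof -
  have "quat_cnj p * r + quat_cnj r * p = of_real (2 * inner p r)" for p r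
    unfolding quat_eq_iff quat_of_real_sel by (simp add: quat_mult_sel inner_quat_def)
  then show ?thesis by (simp add: dq_norm_sq_def dual_eq_iff quat_cnj_mult_self)
qed

lemma quad_form_diagonalizes:
  assumes "diagonalizes U A d"
  shows "quad_form A x = dq_of_dual (\<Sum>i\<in>UNIV. d i * dq_norm_sq ((ctranspose U *v x) $ i))"
proof -
  define y where "y = ctranspose U *v x"
  define z where "z = dual_diag d *v y"
  have "A *v x = (U ** dual_diag d ** ctranspose U) *v x"
    using diagonalizes_imp_eq [OF assms] by simp
  also have "\<dots> = U *v z"
    by (simp add: y_def z_def matrix_vector_mul_assoc matrix_mul_assoc)
  finally have "quad_form A x = (\<Sum>i\<in>UNIV. \<Sum>j\<in>UNIV. dq_cnj (x $ i) * (U $ i $ j * z $ j))"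
    by (simp add: quad_form_def matrix_vector_mult_def sum_distrib_left)
  \<comment> \<open>Exchanging the sums moves \<open>U\<close> to the first argument as its adjoint,
    which produces \<open>y\<close>.\<close>
  also have "\<dots> = (\<Sum>j\<in>UNIV. \<Sum>i\<in>UNIV. dq_cnj (x $ i) * (U $ i $ j * z $ j))"
    by (rule sum.swap)
  also have "\<dots> = (\<Sum>j\<in>UNIV. dq_cnj (y $ j) * z $ j)"
    by (simp add: y_def matrix_vector_mult_def ctranspose_def dq_cnj_sum sum_distrib_right
        mult.assoc)
  also have "\<dots> = (\<Sum>j\<in>UNIV. dq_of_dual (d j * dq_norm_sq (y $ j)))"
  proof (rule sum.cong [OF refl])
    fix j
    have "dq_cnj (y $ j) * z $ j = dq_of_dual (d j) * (dq_cnj (y $ j) * y $ j)"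
      by (simp only: z_def dual_diag_mult_vec mult.assoc [symmetric]
          dq_of_dual_commute [of _ "dq_cnj (y $ j)"])
    then show "dq_cnj (y $ j) * z $ j = dq_of_dual (d j * dq_norm_sq (y $ j))"
      by (simp add: dq_cnj_mult_self)
  qed
  finally show ?thesis by (simp add: dq_of_dual_sum y_def)
qed

text \<open>Each \<open>d i\<close> is itself a value of the form, taken at a vector with
  basis-vector coordinates; definiteness of the form thus passes to the eigenvalues.\<close>

lemma quad_form_column:
  assumes "diagonalizes U A d"
  shows "quad_form A (column i U) = dq_of_dual (d i)"
proof -
  have "ctranspose U *v column i U = column i (mat 1)"
    using assms by (simp add: mult_column diagonalizes_def dq_unitary_def)
  moreover have "dq_norm_sq 0 = 0" "dq_norm_sq 1 = 1"
    by (simp_all add: dq_norm_sq_def dual_eq_iff inner_quat_def)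
  ultimately show ?thesis
    by (simp add: quad_form_diagonalizes [OF assms] column_def mat_def
        if_distrib [of dq_norm_sq] if_distrib [of "\<lambda>x. _ * x"] cong: if_cong)
qed

section \<open>The order of the dual numbers and definiteness\<close>

lemma dual_nonneg_iff:
  "0 \<le> p \<longleftrightarrow> 0 < st_part p \<or> (st_part p = 0 \<and> 0 \<le> eps_part p)" for p :: dual_number
  by (auto simp: less_eq_dual_over_def)

lemma dual_pos_appreciable_iff: "0 < p \<and> appreciable p \<longleftrightarrow> 0 < st_part p" for p :: dual_number
  by (auto simp: less_dual_over_def appreciable_def)

text \<open>If a standard part vanishes, so does that of the product, and the infinitesimal part
  reduces to a product of nonnegative reals or to 0.\<close>

lemma dual_mult_nonneg:
  fixes p q :: dual_number
  assumes "0 \<le> p" "0 \<le> q"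
  shows "0 \<le> p * q"
  using assms by (auto simp: dual_nonneg_iff)

lemma dual_sum_nonneg:
  fixes f :: "'b \<Rightarrow> dual_number"
  assumes "\<And>x. x \<in> S \<Longrightarrow> 0 \<le> f x"
  shows "0 \<le> sum f S"
  using assms
proof (induction S rule: infinite_finite_induct)
  case (insert x S)
  have "0 \<le> f x" "0 \<le> sum f S" using insert by auto
  then show ?case using insert.hyps by (auto simp: dual_nonneg_iff)
qed auto

text \<open>If the standard part is 0, then \<open>st_part q = 0\<close> and the infinitesimal part
  vanishes as well.\<close>

lemma dq_norm_sq_nonneg: "0 \<le> dq_norm_sq q"
  by (auto simp: dual_nonneg_iff dq_norm_sq_def)

lemma dq_pos_semidef_iff:
  assumes "diagonalizes U A d"
  shows "dq_pos_semidef A \<longleftrightarrow> (\<forall>i. 0 \<le> d i)"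
proof
  assume "dq_pos_semidef A"
  then show "\<forall>i. 0 \<le> d i"
    unfolding dq_pos_semidef_def using quad_form_column [OF assms] by (metis dq_of_dual_inject)
next
  assume "\<forall>i. 0 \<le> d i"
  then show "dq_pos_semidef A"
    unfolding dq_pos_semidef_def quad_form_diagonalizes [OF assms]
    by (blast intro: dual_sum_nonneg dual_mult_nonneg dq_norm_sq_nonneg)
qed

lemma dq_pos_def_iff:
  fixes A :: "dual_quat^'n^'n"
  assumes "diagonalizes U A d"
  shows "dq_pos_def A \<longleftrightarrow> (\<forall>i. 0 < d i \<and> appreciable (d i))"
proof
  assume "dq_pos_def A"
  moreover have "appreciable_vec (column i U)" for i
    using diagonalizes_eigenvector [OF assms] by (simp add: dq_eigenvector_def)
  ultimately show "\<forall>i. 0 < d i \<and> appreciable (d i)"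
    unfolding dq_pos_def_def using quad_form_column [OF assms] by (metis dq_of_dual_inject)
next
  assume "\<forall>i. 0 < d i \<and> appreciable (d i)"
  then have d: "0 < st_part (d i)" for i by (simp add: dual_pos_appreciable_iff)
  show "dq_pos_def A"
    unfolding dq_pos_def_def
  proof (intro allI impI exI conjI)
    fix x :: "dual_quat^'n" assume "appreciable_vec x"
    let ?y = "ctranspose U *v x"
    let ?p = "\<Sum>i\<in>UNIV. d i * dq_norm_sq (?y $ i)"
    show "quad_form A x = dq_of_dual ?p" by (rule quad_form_diagonalizes [OF assms])
    have "appreciable_vec ?y"
      using assms \<open>appreciable_vec x\<close>
      by (intro appreciable_vec_unitary_mult) (simp_all add: diagonalizes_def)
    then obtain i where "st_part (?y $ i) \<noteq> 0"
      by (auto simp: appreciable_vec_def appreciable_def)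
    then have "0 < st_part (d i) * inner (st_part (?y $ i)) (st_part (?y $ i))"
      using d by simp
    \<comment> \<open>Only standard parts matter: all terms are nonnegative, and the one at the
      appreciable coordinate is positive.\<close>
    then have "0 < (\<Sum>i\<in>UNIV. st_part (d i) * inner (st_part (?y $ i)) (st_part (?y $ i)))"
      by (rule sum_pos2 [rotated 2]) (simp_all add: d less_imp_le)
    then have "0 < st_part ?p" by (simp add: st_part_sum dq_norm_sq_def)
    then show "0 < ?p" "appreciable ?p" using dual_pos_appreciable_iff by blast+
  qed
qed

theorem theorem4p2:
  fixes A :: "dual_quat^'n^'n"
  assumes "dq_hermitian A" and "st_mat A \<noteq> 0"
  shows "\<exists>L :: dual_number multiset.
    eigenvalue_mset A L \<and> (\<forall>L'. eigenvalue_mset A L' \<longrightarrow> L' = L) \<and>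
    size L = CARD('n) \<and>
    (\<forall>l. right_eigenvalue A l \<longleftrightarrow> l \<in> dq_of_dual ` set_mset L) \<and>
    (\<forall>l. dq_eigenvalue A l \<longleftrightarrow> l \<in># L) \<and>
    (\<exists>U d. diagonalizes U A d \<and> image_mset d (mset_set UNIV) = L \<and>
       (\<forall>i. dq_eigenvector A (d i) (column i U))) \<and>
    (dq_pos_semidef A \<longleftrightarrow> (\<forall>l\<in>#L. 0 \<le> l)) \<and>
    (dq_pos_def A \<longleftrightarrow> (\<forall>l\<in>#L. 0 < l \<and> appreciable l))"
proof -
  obtain U d where U: "diagonalizes U A d"
    using dq_hermitian_diagonalizable [OF assms(1)] by blast
  \<comment> \<open>Any diagonalization may be used, since \<open>diagonalizes_unique\<close> makes
    the multiset independent of it.\<close>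
  define L where "L = image_mset d (mset_set UNIV)"
  have set: "set_mset L = range d" by (simp add: L_def)
  show ?thesis
  proof (intro exI [of _ L] conjI allI impI)
    show "eigenvalue_mset A L" using U L_def by (auto simp: eigenvalue_mset_def)
    show "L' = L" if "eigenvalue_mset A L'" for L'
      using that diagonalizes_unique [OF U] by (auto simp: eigenvalue_mset_def L_def)
    show "size L = CARD('n)" by (simp add: L_def)
    show "right_eigenvalue A l \<longleftrightarrow> l \<in> dq_of_dual ` set_mset L" for l
      by (auto simp: right_eigenvalue_iff [OF U] set)
    show "dq_eigenvalue A l \<longleftrightarrow> l \<in># L" for l
      by (auto simp: dq_eigenvalue_def right_eigenvalue_iff [OF U] set)
    show "\<exists>U d. diagonalizes U A d \<and> image_mset d (mset_set UNIV) = L \<and>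
       (\<forall>i. dq_eigenvector A (d i) (column i U))"
      using U diagonalizes_eigenvector L_def by blast
    show "dq_pos_semidef A \<longleftrightarrow> (\<forall>l\<in>#L. 0 \<le> l)"
      by (auto simp: dq_pos_semidef_iff [OF U] set)
    show "dq_pos_def A \<longleftrightarrow> (\<forall>l\<in>#L. 0 < l \<and> appreciable l)"
      by (auto simp: dq_pos_def_iff [OF U] set)
  qed
qed

end
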